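(* Let $R$ be a local domain whose residue field $k$ has characteristic $0$. Let $S/R$ be a simple extension of degree $n$, and let $q$ be a regular quadratic form over $R$ of rank $m$. Then $N^S_R(D(q_S))\subset D(q)$, where $N^S_R$ is the norm map of $S/R$, $D(q_S)$ is the subgroup of $S^*$ generated by the invertible elements of $S$ of the form $q_S(x)$ with $x\in S^m$, and $D(q)$ is the subgroup of $R^*$ generated by the invertible elements of $R$ of the form $q(y)$ with $y\in R^m$.
   Context: All rings are commutative with unit. A ring extension $S/R$ is a ring $S$ with a ring monomorphism $R\to S$. A ring extension $S/R$ is a simple extension of degree $n$ if there is $c\in S^*$ (an invertible element, called a primitive element) such that $S$ is a free $R$-module with basis $1,c,\dots,c^{n-1}$. For an extension $S/R$ with $S$ free of finite rank as an $R$-module, the norm $N^S_R(s)$ is the determinant of the $R$-linear map $S\to S$ given by multiplication by $s$. $q_S=q\otimes_R S$ denotes the base change of $q$ to $S$ (the same quadratic form, with coefficients in $R$, evaluated on $S^m$). *)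

theory Defs
  imports "HOL-Combinatorics.Permutations"
begin

definition max_ideal :: "'a::comm_ring_1 set" where
  "max_ideal = {x. \<not> x dvd 1}"

definition is_local_ring :: "'a::comm_ring_1 itself \<Rightarrow> bool" where
  "is_local_ring _ \<longleftrightarrow> (0::'a) \<noteq> 1 \<and>
     (\<forall>x\<in>(max_ideal::'a set). \<forall>y\<in>max_ideal. x + y \<in> max_ideal) \<and>
     (\<forall>(r::'a). \<forall>x\<in>max_ideal. r * x \<in> max_ideal)"

definition residue_char_zero :: "'a::comm_ring_1 itself \<Rightarrow> bool" where
  "residue_char_zero _ \<longleftrightarrow> (\<forall>k::nat. k > 0 \<longrightarrow> (of_nat k :: 'a) \<notin> max_ideal)"

definition ring_mono :: "('r::comm_ring_1 \<Rightarrow> 's::comm_ring_1) \<Rightarrow> bool" where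
  "ring_mono \<phi> \<longleftrightarrow> \<phi> 1 = 1 \<and> (\<forall>a b. \<phi> (a + b) = \<phi> a + \<phi> b)
      \<and> (\<forall>a b. \<phi> (a * b) = \<phi> a * \<phi> b) \<and> inj \<phi>"

definition is_basis :: "('r::comm_ring_1 \<Rightarrow> 's::comm_ring_1) \<Rightarrow> nat \<Rightarrow> (nat \<Rightarrow> 's) \<Rightarrow> bool" where
  "is_basis \<phi> n b \<longleftrightarrow> (\<forall>s. \<exists>a. s = (\<Sum>i<n. \<phi> (a i) * b i)) \<and>
     (\<forall>a a'. (\<Sum>i<n. \<phi> (a i) * b i) = (\<Sum>i<n. \<phi> (a' i) * b i) \<longrightarrow> (\<forall>i<n. a i = a' i))"

definition simple_ext :: "('r::comm_ring_1 \<Rightarrow> 's::comm_ring_1) \<Rightarrow> nat \<Rightarrow> 's \<Rightarrow> bool" where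
  "simple_ext \<phi> n c \<longleftrightarrow> ring_mono \<phi> \<and> c dvd 1 \<and> is_basis \<phi> n (\<lambda>i. c ^ i)"

definition coord :: "('r::comm_ring_1 \<Rightarrow> 's::comm_ring_1) \<Rightarrow> nat \<Rightarrow> (nat \<Rightarrow> 's) \<Rightarrow> 's \<Rightarrow> nat \<Rightarrow> 'r" where
  "coord \<phi> n b s = (SOME a. s = (\<Sum>i<n. \<phi> (a i) * b i))"

definition det_nat :: "nat \<Rightarrow> (nat \<Rightarrow> nat \<Rightarrow> 'a::comm_ring_1) \<Rightarrow> 'a" where
  "det_nat n M = (\<Sum>p | p permutes {..<n}. of_int (sign p) * (\<Prod>i<n. M i (p i)))"

definition norm_map :: "('r::comm_ring_1 \<Rightarrow> 's::comm_ring_1) \<Rightarrow> nat \<Rightarrow> (nat \<Rightarrow> 's) \<Rightarrow> 's \<Rightarrow> 'r" where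
  "norm_map \<phi> n b s = det_nat n (\<lambda>i j. coord \<phi> n b (s * b j) i)"

definition qform :: "nat \<Rightarrow> (nat \<Rightarrow> nat \<Rightarrow> 'a::comm_ring_1) \<Rightarrow> (nat \<Rightarrow> 'a) \<Rightarrow> 'a" where
  "qform m a x = (\<Sum>i<m. \<Sum>j<m. if i \<le> j then a i j * x i * x j else 0)"

text \<open>Gram matrix of the polar bilinear form b_q(x,y) = q(x+y) - q(x) - q(y).\<close>
definition polar_gram :: "(nat \<Rightarrow> nat \<Rightarrow> 'a::comm_ring_1) \<Rightarrow> nat \<Rightarrow> nat \<Rightarrow> 'a" where
  "polar_gram a i j = (if i = j then 2 * a i i else if i < j then a i j else a j i)"

definition regular_qform :: "nat \<Rightarrow> (nat \<Rightarrow> nat \<Rightarrow> 'a::comm_ring_1) \<Rightarrow> bool" where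
  "regular_qform m a \<longleftrightarrow> det_nat m (polar_gram a) dvd 1"

inductive_set unit_subgroup :: "'a::comm_ring_1 set \<Rightarrow> 'a set" for G where
  one: "1 \<in> unit_subgroup G"
| mult: "x \<in> unit_subgroup G \<Longrightarrow> g \<in> G \<Longrightarrow> x * g \<in> unit_subgroup G"
| inv: "x \<in> unit_subgroup G \<Longrightarrow> g \<in> G \<Longrightarrow> g * h = 1 \<Longrightarrow> x * h \<in> unit_subgroup G"

definition D_q :: "nat \<Rightarrow> (nat \<Rightarrow> nat \<Rightarrow> 'a::comm_ring_1) \<Rightarrow> 'a set" where
  "D_q m a = unit_subgroup {v. v dvd 1 \<and> (\<exists>x. v = qform m a x)}"

end

theory Submission
  imports Defs "HOL-Algebra.Algebraic_Closure_Type" "Jordan_Normal_Form.Char_Poly"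
begin

text \<open>
  Write \<open>S = R[X]/f\<close> with \<open>f\<close> monic of degree \<open>n\<close>, and a unit value of \<open>q\<close> over \<open>S\<close> as \<open>Q mod f\<close>,
  where \<open>Q = q(v)\<close> for a vector \<open>v\<close> of polynomials of degree less than \<open>n\<close>. Let \<open>N f Q\<close> be the norm of
  \<open>Q\<close> modulo \<open>f\<close>, i.e. the resultant. Interpolating \<open>Q / f\<close> at \<open>n - 2\<close> coinciding points \<open>a\<close> and one
  further point \<open>x\<close> gives
  \<open>Q = \<rho> f h + \<pi> (X - a)^(n - 2) (X - x) p\<close> with \<open>h\<close>, \<open>p\<close> monic of degrees \<open>n - 2\<close>, \<open>n - 1\<close>.
  By multiplicativity and reciprocity of resultants,
  \<open>N f Q * \<rho>^(2n - 2) * N h Q = \<pi>^(2n - 2) * Q(a)^(n - 2) * Q(x) * N p Q\<close>,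
  so the claim follows by induction on \<open>n\<close>, provided \<open>\<rho>\<close>, \<open>\<pi>\<close>, \<open>Q(a)\<close>, \<open>Q(x)\<close> and \<open>N h Q\<close> are units.
  For a generic \<open>x\<close> they are: as \<open>x\<close> tends to a root of \<open>f\<close>, \<open>h\<close> tends to \<open>(X - a)^(n - 2)\<close>.
\<close>

subsection \<open>The norm of a polynomial modulo a monic polynomial\<close>

text \<open>\<open>power_rem f k i\<close> is the coefficient of \<open>X ^ i\<close> in the remainder of \<open>X ^ k\<close> modulo the
  monic polynomial \<open>f\<close>.\<close>

primrec power_rem :: "'a::comm_ring_1 poly \<Rightarrow> nat \<Rightarrow> nat \<Rightarrow> 'a" where
  "power_rem f 0 = (\<lambda>i. if i = 0 then 1 else 0)"
| "power_rem f (Suc k) = (\<lambda>i. (if i = 0 then 0 else power_rem f k (i - 1))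
     - power_rem f k (degree f - 1) * coeff f i)"

text \<open>Built from the recursion rather than from a division operation, each entry is visibly a
  polynomial expression in the coefficients of \<open>f\<close>;
  \<open>polynomial_map_norm_poly\<close> relies on this.\<close>

definition mult_matrix :: "'a::comm_ring_1 poly \<Rightarrow> 'a poly \<Rightarrow> nat \<Rightarrow> nat \<Rightarrow> 'a" where
  "mult_matrix f Q i j = (\<Sum>k\<le>degree Q. coeff Q k * power_rem f (k + j) i)"

definition norm_poly :: "'a::comm_ring_1 poly \<Rightarrow> 'a poly \<Rightarrow> 'a" where
  "norm_poly f Q = det_nat (degree f) (mult_matrix f Q)"

lemma coeff_sum_monom_lessThan: "coeff (\<Sum>i<n. monom (g i) i) k = (if k < n then g k else 0)"
  by (simp add: coeff_sum)

lemma monic_eq_monom_plus: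
  assumes "lead_coeff f = 1"
  shows "f = monom 1 (degree f) + (\<Sum>i<degree f. monom (coeff f i) i)"
  using assms by (intro poly_eqI) (auto simp: coeff_sum_monom_lessThan coeff_eq_0 not_less le_less)

lemma power_rem_cong:
  assumes "lead_coeff f = 1"
  shows "f dvd monom 1 k - (\<Sum>i<degree f. monom (power_rem f k i) i)"
proof (cases "degree f = 0")
  case True
  then have "f = 1"
    using assms monic_eq_monom_plus[of f] by (simp add: monom_0 one_pCons)
  then show ?thesis by simp
next
  case False
  define n where "n = degree f"
  have n: "n > 0" using False by (simp add: n_def)
  show ?thesis
  proof (induction k)
    case 0
    have "(\<Sum>i<n. monom (power_rem f 0 i) i) = monom 1 0"
      using n by (intro poly_eqI) (auto simp: coeff_sum_monom_lessThan)
    then show ?case by (simp add: n_def)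
  next
    case (Suc k)
    define r where "r = power_rem f k"
    have "monom 1 (Suc k) - (\<Sum>i<n. monom (power_rem f (Suc k) i) i)
        = monom 1 1 * (monom 1 k - (\<Sum>i<n. monom (r i) i)) + smult (r (n - 1)) f"
    proof (rule poly_eqI)
      fix i
      have c: "coeff (monom 1 1 * p) i = (if i = 0 then 0 else coeff p (i - 1))" for p :: "'a poly"
        by (cases i) (auto simp: coeff_monom_mult)
      have top: "coeff f i = (if i = n then 1 else 0)" if "i \<ge> n"
        using that assms by (auto simp: n_def coeff_eq_0)
      show "coeff (monom 1 (Suc k) - (\<Sum>i<n. monom (power_rem f (Suc k) i) i)) i
        = coeff (monom 1 1 * (monom 1 k - (\<Sum>i<n. monom (r i) i)) + smult (r (n - 1)) f) i"
        using n top unfolding coeff_diff coeff_add c coeff_sum_monom_lessThan coeff_smult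
        by (cases "i < n") (auto simp: r_def n_def[symmetric])
    qed
    then show ?case
      using Suc unfolding n_def[symmetric] r_def by (simp add: dvd_smult)
  qed
qed

lemma mult_matrix_cong:
  assumes "lead_coeff f = 1"
  shows "f dvd Q * monom 1 j - (\<Sum>i<degree f. monom (mult_matrix f Q i j) i)"
proof -
  have "Q * monom 1 j = (\<Sum>k\<le>degree Q. monom (coeff Q k) k) * monom 1 j"
    by (simp add: poly_as_sum_of_monoms)
  also have "\<dots> = (\<Sum>k\<le>degree Q. smult (coeff Q k) (monom 1 (k + j)))"
    by (simp add: sum_distrib_right mult_monom smult_monom)
  finally have Q: "Q * monom 1 j = (\<Sum>k\<le>degree Q. smult (coeff Q k) (monom 1 (k + j)))" .
  have "(\<Sum>i<degree f. monom (mult_matrix f Q i j) i)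
     = (\<Sum>k\<le>degree Q. smult (coeff Q k) (\<Sum>i<degree f. monom (power_rem f (k + j) i) i))"
    by (intro poly_eqI) (simp add: coeff_sum_monom_lessThan coeff_sum mult_matrix_def)
  then have "Q * monom 1 j - (\<Sum>i<degree f. monom (mult_matrix f Q i j) i)
     = (\<Sum>k\<le>degree Q. smult (coeff Q k)
          (monom 1 (k + j) - (\<Sum>i<degree f. monom (power_rem f (k + j) i) i)))"
    by (simp add: Q sum_subtractf smult_diff_right)
  then show ?thesis
    using power_rem_cong[OF assms] by (simp add: dvd_sum dvd_smult)
qed

section \<open>Norms as products of values at the roots of the modulus\<close>

lemma det_nat_eq_det: "det_nat n M = det (mat n n (\<lambda>(i, j). M i j))"
proof -
  have "(\<Prod>i<n. M i (p i)) = (\<Prod>i = 0..<n. mat n n (\<lambda>(i, j). M i j) $$ (i, p i))"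
    if "p permutes {..<n}" for p
  proof (intro prod.cong)
    fix i assume "i \<in> {0..<n}"
    then show "M i (p i) = mat n n (\<lambda>(i, j). M i j) $$ (i, p i)"
      using permutes_in_image[OF that, of i] by simp
  qed auto
  then have "det_nat n M = (\<Sum>p | p permutes {..<n}. of_int (sign p) *
      (\<Prod>i = 0..<n. mat n n (\<lambda>(i, j). M i j) $$ (i, p i)))"
    unfolding det_nat_def by (intro sum.cong) auto
  then show ?thesis
    by (subst det_def'[of _ n]) (simp_all add: lessThan_atLeast0)
qed

text \<open>Write \<open>P = (X - \<alpha> j) P' + P(\<alpha> j)\<close>: the first summand turns
  \<open>e j\<close> into \<open>P' * e (Suc j)\<close>, which involves only later basis elements.
  The downward induction varies \<open>P\<close> because the quotient \<open>P'\<close> takes its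
  place.\<close>

lemma poly_mult_newton_basis:
  fixes e :: "nat \<Rightarrow> 'a::comm_ring_1 poly"
  assumes e: "\<And>j. j < n \<Longrightarrow> e (Suc j) = [:- \<alpha> j, 1:] * e j" and "j \<le> n"
  shows "\<exists>L. e n dvd P * e j - (\<Sum>k = j..<n. smult (L k) (e k)) \<and> (j < n \<longrightarrow> L j = poly P (\<alpha> j))"
  using \<open>j \<le> n\<close>
proof (induction j arbitrary: P rule: inc_induct)
  case base
  show ?case by simp
next
  case (step j)
  define P' where "P' = synthetic_div P (\<alpha> j)"
  from step obtain L where
    L: "e n dvd P' * e (Suc j) - (\<Sum>k = Suc j..<n. smult (L k) (e k))" by blast
  have P: "P = [:- \<alpha> j, 1:] * P' + [:poly P (\<alpha> j):]"
    by (simp only: P'_def synthetic_div_correct')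
  define L' where "L' = L(j := poly P (\<alpha> j))"
  have "(\<Sum>k = j..<n. smult (L' k) (e k))
      = smult (poly P (\<alpha> j)) (e j) + (\<Sum>k = Suc j..<n. smult (L k) (e k))"
    using step(2) by (simp add: sum.atLeast_Suc_lessThan L'_def)
  moreover have "P * e j = P' * e (Suc j) + smult (poly P (\<alpha> j)) (e j)"
    by (subst P) (simp only: e[OF step(2)], simp add: algebra_simps)
  ultimately have "e n dvd P * e j - (\<Sum>k = j..<n. smult (L' k) (e k))"
    using L by simp
  then show ?case by (auto simp: L'_def)
qed


lemma eq_of_dvd_diff_degree_less:
  fixes f :: "'a::idom poly"
  assumes "f dvd A - B" "\<And>i. i \<ge> degree f \<Longrightarrow> coeff A i = 0" "\<And>i. i \<ge> degree f \<Longrightarrow> coeff B i = 0"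
    "f \<noteq> 0"
  shows "A = B"
proof (rule ccontr)
  assume "A \<noteq> B"
  then have ne: "A - B \<noteq> 0" by simp
  have "degree f \<le> degree (A - B)"
    using assms(1) ne by (rule dvd_imp_degree_le)
  then have "coeff (A - B) (degree (A - B)) = 0"
    using assms(2,3) by simp
  then show False using ne leading_coeff_0_iff by blast
qed

text \<open>In the Newton basis \<open>\<Prod>i<j. (X - \<alpha> i)\<close> multiplication by \<open>Q\<close> is triangular with diagonal
  entries \<open>Q (\<alpha> j)\<close>.\<close>

lemma det_nat_eq_prod_roots:
  fixes Q :: "'a::idom poly"
  assumes M: "\<And>j. j < n \<Longrightarrow>
    (\<Prod>i<n. [:- \<alpha> i, 1:]) dvd Q * monom 1 j - (\<Sum>i<n. monom (M i j) i)"
  shows "det_nat n M = (\<Prod>i<n. poly Q (\<alpha> i))"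
proof -
  define e where "e = (\<lambda>j. \<Prod>i<j. [:- \<alpha> i, 1:])"
  have deg_e: "degree (e j) = j" for j
    by (simp add: e_def degree_prod_eq_sum_degree)
  have lc: "coeff (e j) j = 1" for j
  proof -
    have "lead_coeff (e j) = 1" by (simp add: e_def lead_coeff_prod)
    then show ?thesis by (simp add: deg_e)
  qed
  have e0: "e n \<noteq> 0" using lc[of n] by auto
  have "\<exists>L. e n dvd Q * e j - (\<Sum>k = j..<n. smult (L k) (e k)) \<and> (j < n \<longrightarrow> L j = poly Q (\<alpha> j))"
    if "j \<le> n" for j
    using that by (intro poly_mult_newton_basis) (simp_all add: e_def mult.commute)
  then obtain L where L: "\<And>j. j \<le> n \<Longrightarrow> e n dvd Q * e j - (\<Sum>k = j..<n. smult (L j k) (e k))"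
    and Ld: "\<And>j. j < n \<Longrightarrow> L j j = poly Q (\<alpha> j)"
    by (metis less_imp_le)
  define A where "A = mat n n (\<lambda>(i, j). M i j)"
  define E where "E = mat n n (\<lambda>(i, j). coeff (e j) i)"
  define B where "B = mat n n (\<lambda>(k, j). if k < j then 0 else L j k)"
  have car: "A \<in> carrier_mat n n" "E \<in> carrier_mat n n" "B \<in> carrier_mat n n"
    by (auto simp: A_def E_def B_def)
  \<comment> \<open>Both sides are the coefficient of \<open>X^i\<close> in the remainder of
    \<open>Q * e j\<close> modulo \<open>e n\<close>: \<open>U\<close> computes it through
    monomials, \<open>V\<close> through the Newton basis, and remainders are unique.\<close>
  have entry: "(\<Sum>k<n. M i k * coeff (e j) k) = (\<Sum>k<n. coeff (e k) i * (if k < j then 0 else L j k))"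
    if "i < n" "j < n" for i j
  proof -
    define U where "U = (\<Sum>i<n. monom (\<Sum>k<n. M i k * coeff (e j) k) i)"
    define V where "V = (\<Sum>k = j..<n. smult (L j k) (e k))"
    have ej: "e j = (\<Sum>k<n. smult (coeff (e j) k) (monom 1 k))"
      using that by (intro poly_eqI) (auto simp: smult_monom coeff_sum_monom_lessThan coeff_eq_0 deg_e)
    have "U = (\<Sum>k<n. smult (coeff (e j) k) (\<Sum>i<n. monom (M i k) i))"
      by (intro poly_eqI) (simp add: U_def coeff_sum_monom_lessThan coeff_sum mult.commute)
    then have "Q * e j - U
        = (\<Sum>k<n. smult (coeff (e j) k) (Q * monom 1 k - (\<Sum>i<n. monom (M i k) i)))"
      by (subst ej) (simp add: sum_distrib_left sum_subtractf smult_diff_right)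
    then have "e n dvd Q * e j - U"
      using M by (auto simp: e_def intro!: dvd_sum dvd_smult)
    moreover have "e n dvd Q * e j - V"
      unfolding V_def using that by (intro L) simp
    ultimately have "e n dvd (Q * e j - V) - (Q * e j - U)"
      by (rule dvd_diff[rotated])
    then have "e n dvd U - V" by simp
    then have "U = V"
    proof (rule eq_of_dvd_diff_degree_less)
      show "coeff U i = 0" if "i \<ge> degree (e n)" for i
        using that by (simp add: U_def coeff_sum_monom_lessThan deg_e)
      show "coeff V i = 0" if "i \<ge> degree (e n)" for i
        using that by (auto simp: V_def coeff_sum deg_e coeff_eq_0 intro!: sum.neutral)
    qed (fact e0)
    then have "coeff U i = coeff V i" by simp
    moreover have "coeff V i = (\<Sum>k<n. coeff (e k) i * (if k < j then 0 else L j k))"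
      unfolding V_def coeff_sum by (rule sum.mono_neutral_cong_left) auto
    ultimately show ?thesis
      using that by (simp add: U_def coeff_sum_monom_lessThan)
  qed
  \<comment> \<open>\<open>E\<close> is the unitriangular base change from the Newton basis to
    monomials, so \<open>det A = det B\<close> without inverting \<open>E\<close>.\<close>
  have "A * E = E * B"
    using entry by (intro eq_matI) (auto simp: A_def E_def B_def scalar_prod_def lessThan_atLeast0)
  then have "det A * det E = det E * det B"
    using car by (metis det_mult)
  moreover have "det E = 1"
  proof -
    have "det E = prod_list (diag_mat E)"
      using car(2) by (intro det_upper_triangular[of _ n]) (auto simp: E_def coeff_eq_0 deg_e)
    also have "diag_mat E = map (\<lambda>i. 1) [0..<n]"
      by (auto simp: diag_mat_def E_def lc)
    finally show ?thesis by (simp add: map_replicate_const)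
  qed
  moreover have "det B = (\<Prod>i<n. poly Q (\<alpha> i))"
  proof -
    have "det B = prod_list (diag_mat B)"
      using car(3) by (intro det_lower_triangular[of n]) (auto simp: B_def)
    also have "diag_mat B = map (\<lambda>i. poly Q (\<alpha> i)) [0..<n]"
      by (auto simp: diag_mat_def B_def Ld)
    also have "prod_list \<dots> = (\<Prod>i<n. poly Q (\<alpha> i))"
      by (simp add: prod.distinct_set_conv_list[symmetric] lessThan_atLeast0)
    finally show ?thesis .
  qed
  ultimately show ?thesis
    by (simp add: det_nat_eq_det A_def)
qed

lemma (in comm_ring_hom) hom_det_nat: "hom (det_nat n M) = det_nat n (\<lambda>i j. hom (M i j))"
  by (simp add: det_nat_def hom_distribs)


lemma prod_list_map_mult: "(\<Prod>x\<leftarrow>xs. f x * g x) = (\<Prod>x\<leftarrow>xs. f x) * (\<Prod>x\<leftarrow>xs. g x)"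
  for f g :: "'a \<Rightarrow> 'b::comm_monoid_mult"
  by (induction xs) (simp_all add: ac_simps)

text \<open>Over the algebraic closure of the fraction field every monic polynomial splits; by
  injectivity, identities between norms can be checked there.\<close>

definition closure_embed :: "'a::idom \<Rightarrow> 'a fract alg_closure" where
  "closure_embed x = to_ac (to_fract x)"

interpretation closure_embed: inj_comm_ring_hom closure_embed
  by unfold_locales (auto simp: closure_embed_def)

interpretation closure_embed_poly: map_poly_inj_comm_ring_hom closure_embed ..

lemma ex_roots_in_closure:
  fixes f :: "'a::idom poly"
  assumes "lead_coeff f = 1"
  shows "\<exists>as. length as = degree f \<and> map_poly closure_embed f = (\<Prod>\<alpha>\<leftarrow>as. [:- \<alpha>, 1:])"
proof -
  let ?F = "map_poly closure_embed f"
  have lc: "lead_coeff ?F = 1" and "?F \<noteq> 0" and deg: "degree ?F = degree f"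
    using assms by auto
  then obtain A where A: "size A = degree ?F" "?F = smult (lead_coeff ?F) (\<Prod>x\<in>#A. [:- x, 1:])"
    using alg_closed_imp_factorization by blast
  obtain as where "mset as = A" using ex_mset by blast
  with A(1) deg A(2)[unfolded lc] show ?thesis
    by (intro exI[of _ as]) (auto simp flip: prod_mset_prod_list simp: mset_map)
qed

text \<open>The embedded multiplication matrix satisfies the congruences of
  \<open>det_nat_eq_prod_roots\<close> for the split modulus. This identifies the norm with the
  resultant, from which the rules below follow by comparing products over roots.\<close>

lemma closure_embed_norm_poly:
  fixes f :: "'a::idom poly"
  assumes "lead_coeff f = 1" and f: "map_poly closure_embed f = (\<Prod>\<alpha>\<leftarrow>as. [:- \<alpha>, 1:])"
  shows "closure_embed (norm_poly f Q) = (\<Prod>\<alpha>\<leftarrow>as. poly (map_poly closure_embed Q) \<alpha>)"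
proof -
  let ?h = "map_poly closure_embed"
  have "degree (\<Prod>\<alpha>\<leftarrow>as. [:- \<alpha>, 1:]) = length as"
    by (simp add: degree_linear_factors)
  then have deg: "degree f = length as" by (simp flip: f)
  have nth: "(\<Prod>\<alpha>\<leftarrow>as. g \<alpha>) = (\<Prod>i<length as. g (as ! i))" for g :: "_ \<Rightarrow> 'b::comm_monoid_mult"
    by (simp add: prod.list_conv_set_nth lessThan_atLeast0)
  have "closure_embed (norm_poly f Q)
      = det_nat (length as) (\<lambda>i j. closure_embed (mult_matrix f Q i j))"
    by (simp add: norm_poly_def closure_embed.hom_det_nat deg)
  also have "\<dots> = (\<Prod>i<length as. poly (?h Q) (as ! i))"
  proof (rule det_nat_eq_prod_roots)
    fix j
    have "?h f dvd ?h (Q * monom 1 j - (\<Sum>i<degree f. monom (mult_matrix f Q i j) i))"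
      using mult_matrix_cong[OF assms(1)] by (rule closure_embed_poly.hom_dvd)
    then show "(\<Prod>i<length as. [:- as ! i, 1:]) dvd ?h Q * monom 1 j
       - (\<Sum>i<length as. monom (closure_embed (mult_matrix f Q i j)) i)"
      by (simp add: f nth deg hom_distribs)
  qed
  finally show ?thesis by (simp add: nth)
qed

section \<open>Multiplicativity, change of modulus and reciprocity of norms\<close>

lemma norm_poly_mult:
  fixes f :: "'a::idom poly"
  assumes "lead_coeff f = 1"
  shows "norm_poly f (P * Q) = norm_poly f P * norm_poly f Q"
proof -
  obtain as where "map_poly closure_embed f = (\<Prod>\<alpha>\<leftarrow>as. [:- \<alpha>, 1:])"
    using ex_roots_in_closure[OF assms] by blast
  note * = closure_embed_norm_poly[OF assms this]
  have "closure_embed (norm_poly f (P * Q)) = closure_embed (norm_poly f P * norm_poly f Q)"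
    by (simp add: * hom_distribs prod_list_map_mult)
  then show ?thesis by simp
qed

lemma norm_poly_const:
  fixes f :: "'a::idom poly"
  assumes "lead_coeff f = 1"
  shows "norm_poly f [:r:] = r ^ degree f"
proof -
  obtain as where as: "length as = degree f" "map_poly closure_embed f = (\<Prod>\<alpha>\<leftarrow>as. [:- \<alpha>, 1:])"
    using ex_roots_in_closure[OF assms] by blast
  have "closure_embed (norm_poly f [:r:]) = closure_embed (r ^ degree f)"
    by (simp add: closure_embed_norm_poly[OF assms as(2)] hom_distribs as(1) map_replicate_const)
  then show ?thesis by simp
qed

lemma norm_poly_1:
  fixes f :: "'a::idom poly"
  assumes "lead_coeff f = 1"
  shows "norm_poly f 1 = 1"
  using norm_poly_const[OF assms, of 1] by (simp add: one_pCons)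

lemma norm_poly_smult:
  fixes f :: "'a::idom poly"
  assumes "lead_coeff f = 1"
  shows "norm_poly f (smult r Q) = r ^ degree f * norm_poly f Q"
  using norm_poly_mult[OF assms, of "[:r:]" Q] norm_poly_const[OF assms, of r] by simp

lemma norm_poly_power:
  fixes f :: "'a::idom poly"
  assumes "lead_coeff f = 1"
  shows "norm_poly f (Q ^ k) = norm_poly f Q ^ k"
  by (induction k) (simp_all add: norm_poly_mult norm_poly_1 assms)

lemma norm_poly_cong:
  fixes f :: "'a::idom poly"
  assumes "lead_coeff f = 1" and "f dvd P - Q"
  shows "norm_poly f P = norm_poly f Q"
proof -
  let ?h = "map_poly closure_embed"
  obtain as where as: "?h f = (\<Prod>\<alpha>\<leftarrow>as. [:- \<alpha>, 1:])"
    using ex_roots_in_closure[OF assms(1)] by blast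
  have "poly (?h P) \<alpha> = poly (?h Q) \<alpha>" if "\<alpha> \<in> set as" for \<alpha>
  proof -
    have "poly (?h f) \<alpha> = 0"
      using that by (auto simp: as poly_prod_list prod_list_zero_iff)
    moreover have "?h f dvd ?h (P - Q)"
      using assms(2) by (rule closure_embed_poly.hom_dvd)
    ultimately have "poly (?h (P - Q)) \<alpha> = 0" by auto
    then show ?thesis by (simp add: hom_distribs)
  qed
  then have "closure_embed (norm_poly f P) = closure_embed (norm_poly f Q)"
    by (auto simp: closure_embed_norm_poly[OF assms(1) as] intro!: arg_cong[of _ _ prod_list])
  then show ?thesis by simp
qed

lemma norm_poly_modulus_mult:
  fixes f :: "'a::idom poly"
  assumes "lead_coeff f = 1" and "lead_coeff g = 1"
  shows "norm_poly (f * g) Q = norm_poly f Q * norm_poly g Q"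
proof -
  let ?h = "map_poly closure_embed"
  obtain as where as: "?h f = (\<Prod>\<alpha>\<leftarrow>as. [:- \<alpha>, 1:])"
    using ex_roots_in_closure[OF assms(1)] by blast
  obtain bs where bs: "?h g = (\<Prod>\<alpha>\<leftarrow>bs. [:- \<alpha>, 1:])"
    using ex_roots_in_closure[OF assms(2)] by blast
  have "lead_coeff (f * g) = 1" "?h (f * g) = (\<Prod>\<alpha>\<leftarrow>as @ bs. [:- \<alpha>, 1:])"
    using assms by (simp_all add: lead_coeff_mult hom_distribs as bs)
  from closure_embed_norm_poly[OF this]
  have "closure_embed (norm_poly (f * g) Q) = closure_embed (norm_poly f Q * norm_poly g Q)"
    by (simp add: closure_embed_norm_poly[OF assms(1) as] closure_embed_norm_poly[OF assms(2) bs]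
        hom_distribs)
  then show ?thesis by simp
qed

lemma norm_poly_linear:
  fixes x :: "'a::idom"
  shows "norm_poly [:- x, 1:] Q = poly Q x"
proof -
  have "map_poly closure_embed [:- x, 1:] = (\<Prod>\<alpha>\<leftarrow>[closure_embed x]. [:- \<alpha>, 1:])"
    by (simp add: hom_distribs)
  from closure_embed_norm_poly[OF _ this, of Q]
  have "closure_embed (norm_poly [:- x, 1:] Q) = closure_embed (poly Q x)"
    by simp
  then show ?thesis by simp
qed

lemma norm_poly_linear_power:
  fixes x :: "'a::idom"
  shows "norm_poly ([:- x, 1:] ^ k) Q = poly Q x ^ k"
proof (induction k)
  case 0
  show ?case by (simp add: norm_poly_def det_nat_def)
next
  case (Suc k)
  have "lead_coeff [:- x, 1:] = 1" "lead_coeff ([:- x, 1:] ^ k) = 1"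
    by (simp_all add: lead_coeff_power)
  from norm_poly_modulus_mult[OF this] Suc show ?case
    by (simp only: power_Suc norm_poly_linear)
qed

text \<open>Reciprocity of resultants: both norms are products over all pairs of a root of
  \<open>f\<close> and a root of \<open>g\<close> of their difference, with opposite signs in each
  factor.\<close>

lemma norm_poly_swap:
  fixes f :: "'a::idom poly"
  assumes "lead_coeff f = 1" and "lead_coeff g = 1"
  shows "norm_poly f g = (-1) ^ (degree f * degree g) * norm_poly g f"
proof -
  let ?h = "map_poly closure_embed"
  obtain as where as: "length as = degree f" "?h f = (\<Prod>\<alpha>\<leftarrow>as. [:- \<alpha>, 1:])"
    using ex_roots_in_closure[OF assms(1)] by blast
  obtain bs where bs: "length bs = degree g" "?h g = (\<Prod>\<alpha>\<leftarrow>bs. [:- \<alpha>, 1:])"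
    using ex_roots_in_closure[OF assms(2)] by blast
  have sum1: "(\<Prod>\<beta>\<leftarrow>bs. \<alpha> - \<beta>) = (-1) ^ length bs * (\<Prod>\<beta>\<leftarrow>bs. \<beta> - \<alpha>)" for \<alpha> :: "'a fract alg_closure"
    by (induction bs) (auto simp: algebra_simps)
  have swap: "(\<Prod>\<alpha>\<leftarrow>as. \<Prod>\<beta>\<leftarrow>bs. \<beta> - \<alpha>) = (\<Prod>\<beta>\<leftarrow>bs. \<Prod>\<alpha>\<leftarrow>as. \<beta> - \<alpha>)"
    by (induction as) (auto simp: prod_list_map_mult map_replicate_const)
  have "closure_embed (norm_poly f g) = (\<Prod>\<alpha>\<leftarrow>as. \<Prod>\<beta>\<leftarrow>bs. \<alpha> - \<beta>)"
    by (simp add: closure_embed_norm_poly[OF assms(1) as(2)] bs poly_prod_list o_def)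
  also have "\<dots> = (-1) ^ (length as * length bs) * (\<Prod>\<beta>\<leftarrow>bs. \<Prod>\<alpha>\<leftarrow>as. \<beta> - \<alpha>)"
    unfolding sum1 prod_list_map_mult swap by (simp add: map_replicate_const power_mult[symmetric] mult.commute)
  also have "(\<Prod>\<beta>\<leftarrow>bs. \<Prod>\<alpha>\<leftarrow>as. \<beta> - \<alpha>) = closure_embed (norm_poly g f)"
    by (simp add: closure_embed_norm_poly[OF assms(2) bs(2)] as poly_prod_list o_def)
  finally have "closure_embed (norm_poly f g)
      = closure_embed ((-1) ^ (degree f * degree g) * norm_poly g f)"
    by (simp add: as bs hom_distribs)
  then show ?thesis by simp
qed

subsection \<open>Units in local domains\<close>

locale local_domain =
  fixes R :: "'r::idom itself"
  assumes local: "is_local_ring R"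
begin

lemma unit_iff: "(x::'r) dvd 1 \<longleftrightarrow> x \<notin> max_ideal"
  by (simp add: max_ideal_def)

lemma max_ideal_mult: "(x::'r) \<in> max_ideal \<Longrightarrow> r * x \<in> max_ideal"
  and max_ideal_add: "(x::'r) \<in> max_ideal \<Longrightarrow> y \<in> max_ideal \<Longrightarrow> x + y \<in> max_ideal"
  using local by (auto simp: is_local_ring_def)

lemma max_ideal_mult2: "(x::'r) \<in> max_ideal \<Longrightarrow> x * r \<in> max_ideal"
  using max_ideal_mult[of x r] by (simp add: mult.commute)

lemma max_ideal_0: "(0::'r) \<in> max_ideal"
  by (simp add: max_ideal_def)

lemma max_ideal_diff: "(x::'r) \<in> max_ideal \<Longrightarrow> y \<in> max_ideal \<Longrightarrow> x - y \<in> max_ideal"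
  using max_ideal_add[of x "- 1 * y"] max_ideal_mult[of y "-1"] by simp

lemma max_ideal_sum: "(\<And>i. i \<in> I \<Longrightarrow> (g i::'r) \<in> max_ideal) \<Longrightarrow> sum g I \<in> max_ideal"
  by (induction I rule: infinite_finite_induct) (auto simp: max_ideal_0 intro: max_ideal_add)

text \<open>Every Leibniz term contains an entry from row 0; for \<open>n = 0\<close> the
  determinant would be the empty product 1.\<close>

lemma det_nat_max_ideal:
  assumes "n > 0" and "\<And>i j. (M i j::'r) \<in> max_ideal"
  shows "det_nat n M \<in> max_ideal"
  unfolding det_nat_def
proof (intro max_ideal_sum max_ideal_mult)
  fix p
  have "(\<Prod>i<n. M i (p i)) = M 0 (p 0) * (\<Prod>i\<in>{..<n} - {0}. M i (p i))"
    using assms(1) by (intro prod.remove) auto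
  then show "(\<Prod>i<n. M i (p i)) \<in> max_ideal"
    using assms(2) by (auto intro: max_ideal_mult2)
qed

section \<open>Polynomials whose reduction over the residue field is nonzero\<close>

definition has_unit_coeff :: "'r poly \<Rightarrow> bool" where
  "has_unit_coeff P \<longleftrightarrow> (\<exists>k. coeff P k dvd 1)"

lemma has_unit_coeff_top:
  assumes "has_unit_coeff P"
  obtains k where "coeff P k dvd 1" "\<And>i. i > k \<Longrightarrow> coeff P i \<in> max_ideal"
proof -
  have fin: "finite {k. coeff P k dvd 1}"
    by (rule finite_subset[of _ "{..degree P}"]) (auto intro: le_degree)
  show ?thesis
  proof (rule that[of "Max {k. coeff P k dvd 1}"])
    show "coeff P (Max {k. coeff P k dvd 1}) dvd 1"
      using Max_in[OF fin] assms by (auto simp: has_unit_coeff_def)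
    show "coeff P i \<in> max_ideal" if "i > Max {k. coeff P k dvd 1}" for i
      using Max_ge[OF fin, of i] that unfolding max_ideal_def by force
  qed
qed

text \<open>Gauss's lemma: if \<open>k\<close> and \<open>l\<close> are the last indices with unit
  coefficients, coefficient \<open>k + l\<close> of the product is a unit plus an element of the
  maximal ideal.\<close>

lemma has_unit_coeff_mult:
  assumes "has_unit_coeff P" "has_unit_coeff Q"
  shows "has_unit_coeff (P * Q)"
proof -
  obtain k where k: "coeff P k dvd 1" "\<And>i. i > k \<Longrightarrow> coeff P i \<in> max_ideal"
    using has_unit_coeff_top[OF assms(1)] by blast
  obtain l where l: "coeff Q l dvd 1" "\<And>i. i > l \<Longrightarrow> coeff Q i \<in> max_ideal"
    using has_unit_coeff_top[OF assms(2)] by blast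
  define c where "c = (\<Sum>i\<in>{..k + l} - {k}. coeff P i * coeff Q (k + l - i))"
  have "coeff (P * Q) (k + l) = coeff P k * coeff Q l + c"
    unfolding c_def coeff_mult by (subst sum.remove[of _ k]) auto
  moreover have "c \<in> max_ideal"
    unfolding c_def
  proof (rule max_ideal_sum)
    fix i assume "i \<in> {..k + l} - {k}"
    \<comment> \<open>Any other term of the convolution has an index beyond the last unit
      coefficient of \<open>P\<close> or of \<open>Q\<close>.\<close>
    then have "i > k \<or> k + l - i > l" by auto
    then show "coeff P i * coeff Q (k + l - i) \<in> max_ideal"
      using k(2) l(2) max_ideal_mult max_ideal_mult2 by blast
  qed
  moreover have "coeff P k * coeff Q l dvd 1"
    using k(1) l(1) by (simp add: is_unit_mult_iff)
  ultimately have "coeff (P * Q) (k + l) dvd 1"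
    using max_ideal_diff[of "coeff (P * Q) (k + l)" c] by (auto simp: unit_iff)
  then show ?thesis by (auto simp: has_unit_coeff_def)
qed

text \<open>Otherwise all entries of the multiplication matrix, and hence its determinant, would lie
  in the maximal ideal.\<close>

lemma has_unit_coeff_if_norm_poly_unit:
  assumes "degree f > 0" and "norm_poly f Q dvd 1"
  shows "has_unit_coeff Q"
proof (rule ccontr)
  assume "\<not> has_unit_coeff Q"
  then have "coeff Q k \<in> max_ideal" for k
    by (auto simp: has_unit_coeff_def max_ideal_def)
  then have "norm_poly f Q \<in> max_ideal"
    unfolding norm_poly_def mult_matrix_def
    by (intro det_nat_max_ideal assms(1) max_ideal_sum max_ideal_mult2)
  with assms(2) show False by (simp add: unit_iff)
qed

text \<open>Over the residue field this says that a polynomial vanishing at all large natural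
  numbers is zero. Splitting off \<open>X - N\<close> lowers the degree; the differences
  \<open>x - N\<close> are units for \<open>x > N\<close> by residue characteristic 0, so the
  quotient satisfies the hypothesis from \<open>Suc N\<close> on.\<close>

lemma coeff_max_ideal_if_values:
  assumes char: "residue_char_zero R"
    and "degree P \<le> d" and "\<And>x. x \<ge> N \<Longrightarrow> poly P (of_nat x :: 'r) \<in> max_ideal"
  shows "coeff P k \<in> max_ideal"
  using assms(2,3)
proof (induction d arbitrary: P N k)
  case 0
  then obtain c where "P = [:c:]" by (auto elim: degree_eq_zeroE)
  with 0(2)[of N] show ?case by (cases k) (auto simp: max_ideal_0)
next
  case (Suc d)
  define P' where "P' = synthetic_div P (of_nat N)"
  have P: "P = [:- of_nat N, 1:] * P' + [:poly P (of_nat N):]"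
    by (simp only: P'_def synthetic_div_correct')
  have "coeff P' k \<in> max_ideal" for k
  proof (rule Suc.IH)
    show "degree P' \<le> d" using Suc.prems(1) by (simp add: P'_def degree_synthetic_div)
    fix x assume "x \<ge> Suc N"
    then have d: "(of_nat x - of_nat N :: 'r) = of_nat (x - N)" by (simp add: of_nat_diff)
    have "poly P (of_nat x) = (of_nat x - of_nat N) * poly P' (of_nat x) + poly P (of_nat N)"
      by (subst P) (simp add: algebra_simps)
    then have "of_nat (x - N) * poly P' (of_nat x) = poly P (of_nat x) - poly P (of_nat N)"
      by (simp add: d)
    then have "of_nat (x - N) * poly P' (of_nat x) \<in> max_ideal"
      using Suc.prems(2)[of x] Suc.prems(2)[of N] \<open>x \<ge> Suc N\<close> by (simp add: max_ideal_diff)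
    moreover have "x - N > 0" using \<open>x \<ge> Suc N\<close> by simp
    then have "(of_nat (x - N) :: 'r) dvd 1"
      using char unfolding residue_char_zero_def unit_iff by blast
    ultimately show "poly P' (of_nat x) \<in> max_ideal"
      by (auto simp: max_ideal_def is_unit_mult_iff)
  qed
  moreover have "poly P (of_nat N) \<in> max_ideal" using Suc.prems(2) by simp
  moreover have "coeff P k = - of_nat N * coeff P' k + (if k = 0 then 0 else coeff P' (k - 1))
      + (if k = 0 then poly P (of_nat N) else 0)"
    by (subst P) (cases k, auto simp: coeff_pCons)
  ultimately show ?case
    by (auto simp del: mult_minus_left intro!: max_ideal_add max_ideal_mult max_ideal_0)
qed

lemma ex_unit_value:
  assumes "residue_char_zero R" and "has_unit_coeff P"
  shows "\<exists>x. poly P x dvd 1"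
proof (rule ccontr)
  assume "\<nexists>x. poly P x dvd 1"
  then have "coeff P k \<in> max_ideal" for k
    by (intro coeff_max_ideal_if_values[OF assms(1) order_refl]) (auto simp: max_ideal_def)
  then show False using assms(2) by (auto simp: has_unit_coeff_def unit_iff)
qed

end

subsection \<open>Polynomial dependence of the norm on the modulus\<close>

definition polynomial_map :: "('a::comm_ring_1 \<Rightarrow> 'a) \<Rightarrow> bool" where
  "polynomial_map g \<longleftrightarrow> (\<exists>P. \<forall>x. g x = poly P x)"

lemma polynomial_map_const [intro]: "polynomial_map (\<lambda>x. r)"
  unfolding polynomial_map_def by (rule exI[of _ "[:r:]"]) simp

lemma polynomial_map_ident [intro]: "polynomial_map (\<lambda>x. x)"
  unfolding polynomial_map_def by (rule exI[of _ "[:0, 1:]"]) simp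

lemma polynomial_map_add [intro]:
  "polynomial_map g \<Longrightarrow> polynomial_map h \<Longrightarrow> polynomial_map (\<lambda>x. g x + h x)"
  unfolding polynomial_map_def by (metis poly_add)

lemma polynomial_map_diff [intro]:
  "polynomial_map g \<Longrightarrow> polynomial_map h \<Longrightarrow> polynomial_map (\<lambda>x. g x - h x)"
  unfolding polynomial_map_def by (metis poly_diff)

lemma polynomial_map_mult [intro]:
  "polynomial_map g \<Longrightarrow> polynomial_map h \<Longrightarrow> polynomial_map (\<lambda>x. g x * h x)"
  unfolding polynomial_map_def by (metis poly_mult)

lemma polynomial_map_sum [intro]:
  "(\<And>i. i \<in> I \<Longrightarrow> polynomial_map (g i)) \<Longrightarrow> polynomial_map (\<lambda>x. \<Sum>i\<in>I. g i x)"
  by (induction I rule: infinite_finite_induct) auto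

lemma polynomial_map_prod [intro]:
  "(\<And>i. i \<in> I \<Longrightarrow> polynomial_map (g i)) \<Longrightarrow> polynomial_map (\<lambda>x. \<Prod>i\<in>I. g i x)"
  by (induction I rule: infinite_finite_induct) auto

lemma monic_add_lower:
  fixes f :: "'a::comm_ring_1 poly"
  assumes "lead_coeff f = 1" and "\<And>i. i \<ge> degree f \<Longrightarrow> coeff h i = 0"
  shows "degree (f + h) = degree f" and "lead_coeff (f + h) = 1"
proof -
  have "coeff (f + h) (degree f) = 1" using assms by simp
  then have "degree (f + h) \<ge> degree f" by (intro le_degree) simp
  moreover have "degree (f + h) \<le> degree f"
    using assms(2) by (intro degree_le) (auto simp: coeff_eq_0)
  ultimately show d: "degree (f + h) = degree f" by simp
  show "lead_coeff (f + h) = 1" using assms by (simp add: d)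
qed

text \<open>As \<open>h\<close> has lower degree, the size of the matrix does not vary with
  \<open>t\<close>, and the recursion for \<open>power_rem\<close> keeps each entry polynomial in
  \<open>t\<close>.\<close>

lemma polynomial_map_norm_poly:
  fixes f :: "'a::comm_ring_1 poly"
  assumes "lead_coeff f = 1" and h: "\<And>i. i \<ge> degree f \<Longrightarrow> coeff h i = 0"
  shows "polynomial_map (\<lambda>t. norm_poly (f + smult t h) Q)"
proof -
  have deg: "degree (f + smult t h) = degree f" for t
    using assms by (intro monic_add_lower) simp_all
  have *: "polynomial_map (\<lambda>t. power_rem (f + smult t h) k i)" for k i
  proof (induction k arbitrary: i)
    case 0
    show ?case by auto
  next
    case (Suc k)
    have "polynomial_map (\<lambda>t. if i = 0 then 0 else power_rem (f + smult t h) k (i - 1))"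
      using Suc by (cases "i = 0") auto
    then show ?case
      unfolding power_rem.simps deg coeff_add coeff_smult
      by (intro polynomial_map_diff polynomial_map_mult polynomial_map_add polynomial_map_const
          polynomial_map_ident Suc)
  qed
  show ?thesis
    unfolding norm_poly_def det_nat_def mult_matrix_def deg
    by (intro polynomial_map_sum polynomial_map_mult polynomial_map_prod polynomial_map_const *)
qed

text \<open>\<open>H\<close> is the homogenization of \<open>P\<close> evaluated at
  \<open>(f, G)\<close>; it clears the denominator in \<open>t = f(x) / G(x)\<close>, so a unit
  value \<open>H(x)\<close> makes \<open>P(t)\<close> a unit. Modulo \<open>f\<close> only the
  constant term of \<open>P\<close> survives.\<close>

lemma homogenize_poly:
  fixes P f G :: "'a::comm_ring_1 poly"
  obtains H where "\<And>x t. t * poly G x = poly f x \<Longrightarrow> poly H x = poly G x ^ degree P * poly P t"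
    and "f dvd H - smult (poly P 0) (G ^ degree P)"
proof
  define D where "D = degree P"
  define H where "H = (\<Sum>i\<le>D. smult (coeff P i) (f ^ i * G ^ (D - i)))"
  show "poly H x = poly G x ^ degree P * poly P t" if t: "t * poly G x = poly f x" for x t
  proof -
    have "poly f x ^ i * poly G x ^ (D - i) = poly G x ^ D * t ^ i" if "i \<le> D" for i
    proof -
      have "poly G x ^ D = poly G x ^ i * poly G x ^ (D - i)"
        using that by (simp flip: power_add)
      then show ?thesis by (simp add: t[symmetric] power_mult_distrib ac_simps)
    qed
    then have "poly H x = (\<Sum>i\<le>D. coeff P i * (poly G x ^ D * t ^ i))"
      by (simp add: H_def poly_sum)
    also have "\<dots> = poly G x ^ D * poly P t"
      by (simp add: poly_altdef[of P] D_def sum_distrib_left ac_simps)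
    finally show ?thesis by (simp add: D_def)
  qed
  have "H = smult (coeff P 0) (G ^ D) + (\<Sum>i\<in>{..D} - {0}. smult (coeff P i) (f ^ i * G ^ (D - i)))"
    unfolding H_def by (subst sum.remove[of _ 0]) auto
  moreover have "f dvd (\<Sum>i\<in>{..D} - {0}. smult (coeff P i) (f ^ i * G ^ (D - i)))"
    by (intro dvd_sum dvd_smult dvd_mult2) (auto intro: dvd_power)
  ultimately show "f dvd H - smult (poly P 0) (G ^ degree P)"
    by (simp add: poly_0_coeff_0 D_def)
qed

text \<open>\<open>h\<close> is the quotient \<open>Q / f\<close> expanded at \<open>a\<close> up to
  order \<open>k\<close>. Each step adds the multiple of \<open>(X - a)^k\<close> that makes the
  cofactor \<open>G\<close> vanish at \<open>a\<close>, which is possible because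
  \<open>f(a)\<close> is a unit.\<close>

lemma ex_divided_modulo_linear_power:
  fixes f Q :: "'a::comm_ring_1 poly"
  assumes "poly f a dvd 1"
  shows "\<exists>h G. Q = f * h + [:- a, 1:] ^ k * G \<and> (\<forall>i\<ge>k. coeff h i = 0)"
proof (induction k)
  case 0
  show ?case by (intro exI[of _ 0] exI[of _ Q]) simp
next
  case (Suc k)
  then obtain h G where hG: "Q = f * h + [:- a, 1:] ^ k * G" "\<forall>i\<ge>k. coeff h i = 0" by blast
  obtain u where u: "1 = poly f a * u" using assms by (auto elim: dvdE)
  define \<rho> where "\<rho> = poly G a * u"
  have "poly (G - smult \<rho> f) a = poly G a - poly G a * (poly f a * u)"
    by (simp add: \<rho>_def algebra_simps)
  then have "poly (G - smult \<rho> f) a = 0" by (simp flip: u)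
  then obtain G' where G': "G - smult \<rho> f = [:- a, 1:] * G'"
    unfolding poly_eq_0_iff_dvd by (elim dvdE)
  have "Q = f * (h + smult \<rho> ([:- a, 1:] ^ k)) + [:- a, 1:] ^ k * (G - smult \<rho> f)"
    by (simp add: hG(1) algebra_simps smult_diff_right)
  also have "\<dots> = f * (h + smult \<rho> ([:- a, 1:] ^ k)) + [:- a, 1:] ^ Suc k * G'"
    by (simp only: G' power_Suc2 mult.assoc)
  finally have "Q = f * (h + smult \<rho> ([:- a, 1:] ^ k)) + [:- a, 1:] ^ Suc k * G'" .
  moreover have "degree ([:- a, 1:] ^ k) \<le> k"
    using degree_power_le[of "[:- a, 1:]" k] by simp
  then have "\<forall>i\<ge>Suc k. coeff (h + smult \<rho> ([:- a, 1:] ^ k)) i = 0"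
    using hG(2) by (auto simp: coeff_eq_0)
  ultimately show ?case by blast
qed

subsection \<open>Values of quadratic forms\<close>

lemma unit_subgroup_mult:
  "y \<in> unit_subgroup G \<Longrightarrow> x \<in> unit_subgroup G \<Longrightarrow> x * y \<in> unit_subgroup G"
  by (induction y rule: unit_subgroup.induct)
    (auto simp flip: mult.assoc intro: unit_subgroup.intros)

text \<open>Peel off the last factor: if \<open>y\<close> inverts \<open>x * g\<close>, then
  \<open>g * y\<close> inverts \<open>x\<close>, and multiplying it by \<open>x * y\<close>, the
  inverse of \<open>g\<close>, gives back \<open>y\<close>.\<close>

lemma unit_subgroup_inverse:
  "x \<in> unit_subgroup G \<Longrightarrow> x * y = 1 \<Longrightarrow> y \<in> unit_subgroup G"
proof (induction x arbitrary: y rule: unit_subgroup.induct)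
  case one
  then show ?case by (auto intro: unit_subgroup.one)
next
  case (mult x g)
  have "g * y \<in> unit_subgroup G" by (rule mult.IH) (use mult.prems in \<open>simp add: mult.assoc\<close>)
  moreover have "g * (x * y) = 1" using mult.prems by (simp add: ac_simps)
  ultimately have "g * y * (x * y) \<in> unit_subgroup G"
    using mult.hyps by (metis unit_subgroup.inv)
  also have "g * y * (x * y) = (x * g * y) * y" by (simp add: ac_simps)
  finally show ?case using mult.prems by simp
next
  case (inv x g h)
  have "h * y \<in> unit_subgroup G" by (rule inv.IH) (use inv.prems in \<open>simp add: mult.assoc\<close>)
  then have "h * y * g \<in> unit_subgroup G"
    using inv.hyps by (metis unit_subgroup.mult)
  also have "h * y * g = (g * h) * y" by (simp add: ac_simps)
  finally show ?case using inv.hyps by simp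
qed

lemma unit_subgroup_dvd_1:
  "x \<in> unit_subgroup G \<Longrightarrow> (\<And>g. g \<in> G \<Longrightarrow> g dvd 1) \<Longrightarrow> x dvd 1"
proof (induction x rule: unit_subgroup.induct)
  case (mult x g)
  then have "x * g dvd 1 * 1" by (intro mult_dvd_mono) auto
  then show ?case by simp
next
  case (inv x g h)
  then have "x * h dvd 1 * 1" by (intro mult_dvd_mono) (auto intro: dvdI[of _ _ g] simp: mult.commute)
  then show ?case by simp
qed simp

lemma dvd_one_power: "x dvd 1 \<Longrightarrow> x ^ k dvd 1" for x :: "'a::comm_semiring_1"
  using dvd_power_same[of x 1 k] by simp

lemma D_q_dvd_1: "x \<in> D_q m a \<Longrightarrow> x dvd 1"
  unfolding D_q_def by (erule unit_subgroup_dvd_1) simp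

lemma D_q_mult: "x \<in> D_q m a \<Longrightarrow> y \<in> D_q m a \<Longrightarrow> x * y \<in> D_q m a"
  unfolding D_q_def by (rule unit_subgroup_mult)

lemma D_q_one: "1 \<in> D_q m a"
  unfolding D_q_def by (rule unit_subgroup.one)

lemma D_q_power: "x \<in> D_q m a \<Longrightarrow> x ^ k \<in> D_q m a"
  by (induction k) (auto intro: D_q_mult D_q_one)

lemma D_q_cancel:
  assumes "x * y \<in> D_q m a" and "y \<in> D_q m a"
  shows "x \<in> D_q m a"
proof -
  obtain z where z: "y * z = 1" using D_q_dvd_1[OF assms(2)] by (metis dvdE)
  then have "z \<in> D_q m a"
    using assms(2) unfolding D_q_def by (rule unit_subgroup_inverse[rotated])
  then have "x * y * z \<in> D_q m a" by (rule D_q_mult[OF assms(1)])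
  then show ?thesis using z by (simp add: mult.assoc)
qed

lemma D_q_value: "qform m a x dvd 1 \<Longrightarrow> qform m a x \<in> D_q m a"
  unfolding D_q_def
  using unit_subgroup.mult[OF unit_subgroup.one, of "qform m a x" "{v. v dvd 1 \<and> (\<exists>x. v = qform m a x)}"]
  by auto

lemma qform_scale: "qform m a (\<lambda>i. r * x i) = r\<^sup>2 * qform m a x"
  by (auto simp: qform_def sum_distrib_left power2_eq_square ac_simps intro!: sum.cong)

text \<open>The square is the quotient of the two unit values at \<open>r x\<close> and at
  \<open>x\<close>, which is why some unit value has to exist.\<close>

lemma D_q_square:
  assumes "qform m a x dvd 1" and "r dvd 1"
  shows "r\<^sup>2 \<in> D_q m a"
proof (rule D_q_cancel)
  have "r\<^sup>2 dvd 1\<^sup>2" using assms(2) by (rule dvd_power_same)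
  with assms(1) have "r\<^sup>2 * qform m a x dvd 1 * 1" by (intro mult_dvd_mono) auto
  then show "r\<^sup>2 * qform m a x \<in> D_q m a"
    using D_q_value[of m a "\<lambda>i. r * x i"] by (simp add: qform_scale)
qed (rule D_q_value[OF assms(1)])

section \<open>Quadratic forms with polynomial arguments\<close>

lemma poly_qform: "poly (qform m (\<lambda>i j. [:a i j:]) v) x = qform m a (\<lambda>i. poly (v i) x)"
  by (auto simp: qform_def poly_sum intro!: sum.cong)

lemma qform_cong_dvd:
  fixes f :: "'a::comm_ring_1"
  assumes "\<And>i. f dvd v i - w i"
  shows "f dvd qform m a v - qform m a w"
proof -
  have "f dvd a i j * v i * v j - a i j * w i * w j" for i j
  proof -
    have "a i j * v i * v j - a i j * w i * w j = a i j * v i * (v j - w j) + a i j * w j * (v i - w i)"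
      by (simp add: algebra_simps)
    then show ?thesis using assms by simp
  qed
  then show ?thesis
    unfolding qform_def sum_subtractf[symmetric] by (intro dvd_sum) auto
qed

lemma degree_qform_le:
  assumes "\<And>i. degree (v i) \<le> d"
  shows "degree (qform m (\<lambda>i j. [:a i j:]) v) \<le> 2 * d"
proof -
  have "degree ([:a i j:] * v i * v j) \<le> 2 * d" for i j
  proof -
    have "degree ([:a i j:] * v i * v j) \<le> degree ([:a i j:] * v i) + degree (v j)"
      by (rule degree_mult_le)
    also have "degree ([:a i j:] * v i) \<le> degree [:a i j:] + degree (v i)"
      by (rule degree_mult_le)
    finally show ?thesis using assms[of i] assms[of j] by simp
  qed
  then show ?thesis
    unfolding qform_def by (intro degree_sum_le) auto
qed

text \<open>For a monic divisor pseudo-division is ordinary division, so no field is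
  required.\<close>

lemma ex_monic_remainder:
  fixes f p :: "'a::comm_ring_1 poly"
  assumes "lead_coeff f = 1"
  shows "\<exists>r. f dvd p - r \<and> (\<forall>i\<ge>degree f. coeff r i = 0)"
proof -
  obtain q r where qr: "pseudo_divmod p f = (q, r)" by fastforce
  have "f \<noteq> 0" using assms by auto
  from pseudo_divmod[OF this qr] assms have "p = f * q + r" "r = 0 \<or> degree r < degree f"
    by simp_all
  then show ?thesis by (intro exI[of _ r]) (auto simp: coeff_eq_0)
qed

subsection \<open>The norm principle for polynomials\<close>

context local_domain
begin

text \<open>All conditions imposed on \<open>x\<close> in the proof say that some polynomial in \<open>x\<close> has a unit value.
  Apart from \<open>f\<close> itself, each of these polynomials becomes a unit in \<open>R[X]/f\<close>, so it is nonzero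
  over the residue field, which is infinite.\<close>

lemma norm_poly_reduction:
  fixes f Q :: "'r poly" and n :: nat
  assumes char: "residue_char_zero R"
    and monic: "lead_coeff f = 1" and n: "degree f = n" "n \<ge> 2"
    and degQ: "degree Q \<le> 2 * (n - 1)" and unit: "norm_poly f Q dvd 1"
  obtains a x \<pi> \<rho> p h where
    "lead_coeff p = 1" "degree p = n - 1" "lead_coeff h = 1" "degree h = n - 2"
    "\<pi> dvd 1" "\<rho> dvd 1" "poly Q a dvd 1" "poly Q x dvd 1" "norm_poly h Q dvd 1"
    "norm_poly f Q * (\<rho> ^ (n - 1))\<^sup>2 * norm_poly h Q
      = (\<pi> ^ (n - 1))\<^sup>2 * poly Q a ^ (n - 2) * poly Q x * norm_poly p Q"
proof -
  have f_unit: "has_unit_coeff f"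
    unfolding has_unit_coeff_def using monic by (intro exI[of _ n]) (simp add: n)
  have ex: "\<exists>x. poly f x dvd 1 \<and> poly P x dvd 1" if "norm_poly f P dvd 1" for P
  proof -
    have "has_unit_coeff (f * P)"
      using that n by (intro has_unit_coeff_mult f_unit has_unit_coeff_if_norm_poly_unit[of f]) auto
    from ex_unit_value[OF char this] show ?thesis by (auto simp: is_unit_mult_iff)
  qed
  obtain a where a: "poly f a dvd 1" "poly Q a dvd 1" using ex[OF unit] by blast
  \<comment> \<open>\<open>r\<close> is the value at \<open>t = 0\<close> of the moduli
    \<open>r + t h0\<close>, among which \<open>h\<close> will be found.\<close>
  define r where "r = [:- a, 1:] ^ (n - 2)"
  have r: "lead_coeff r = 1" "degree r = n - 2"
    unfolding r_def lead_coeff_power by (simp_all add: degree_linear_power)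
  obtain h0 G where QG: "Q = f * h0 + r * G" and h0: "\<And>i. i \<ge> degree r \<Longrightarrow> coeff h0 i = 0"
    using ex_divided_modulo_linear_power[OF a(1), of Q "n - 2"] by (auto simp: r_def[symmetric] r)
  have degG: "degree G \<le> n"
  proof (cases "G = 0")
    case False
    have "degree h0 \<le> n - 2" using h0 by (intro degree_le) (simp add: r)
    then have "degree (f * h0) \<le> 2 * (n - 1)"
      using degree_mult_le[of f h0] n by linarith
    then have "degree (Q - f * h0) \<le> 2 * (n - 1)"
      using degQ by (rule degree_diff_le[rotated])
    moreover have "degree (r * G) = n - 2 + degree G"
      using False r by (subst degree_mult_eq) auto
    ultimately show ?thesis using n QG by simp
  qed simp
  \<comment> \<open>\<open>\<Phi>\<close> gives the norm of \<open>Q\<close> as the modulus varies.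
    Homogenizing it turns the condition that \<open>norm_poly h Q\<close> is a unit into a condition
    on \<open>x\<close>.\<close>
  obtain \<Phi> where \<Phi>: "\<And>t. norm_poly (r + smult t h0) Q = poly \<Phi> t"
    using polynomial_map_norm_poly[OF r(1) h0] unfolding polynomial_map_def by blast
  obtain H where H: "\<And>x t. t * poly G x = poly f x \<Longrightarrow> poly H x = poly G x ^ degree \<Phi> * poly \<Phi> t"
    and H0: "f dvd H - smult (poly \<Phi> 0) (G ^ degree \<Phi>)"
    using homogenize_poly[of G f \<Phi>] by metis
  have "poly \<Phi> 0 = poly Q a ^ (n - 2)"
    using \<Phi>[of 0] by (simp add: r_def norm_poly_linear_power)
  then have \<Phi>0: "poly \<Phi> 0 dvd 1" using a(2) by (simp add: dvd_one_power)
  have "norm_poly f Q = norm_poly f r * norm_poly f G"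
    using norm_poly_cong[OF monic, of Q "r * G"] by (simp add: QG norm_poly_mult[OF monic])
  then have G_unit: "norm_poly f G dvd 1" using unit by (simp add: is_unit_mult_iff)
  \<comment> \<open>With \<open>\<rho> = G(x) / f(x)\<close>, \<open>W(x)\<close> is
    \<open>f(x)\<close> times the top coefficient of \<open>G - \<rho> f\<close>, so a unit value of
    \<open>W\<close> makes that coefficient a unit. Modulo \<open>f\<close>, \<open>W\<close> is
    \<open>-G\<close>.\<close>
  define W where "W = smult (coeff G n) f - G"
  have "norm_poly f W = norm_poly f (smult (-1) G)"
    by (intro norm_poly_cong[OF monic]) (simp add: W_def dvd_smult)
  also have "\<dots> = (-1) ^ n * norm_poly f G"
    by (simp only: norm_poly_smult[OF monic] n)
  finally have W_unit: "norm_poly f W dvd 1"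
    using G_unit by (simp add: is_unit_mult_iff dvd_one_power)
  have "norm_poly f H = poly \<Phi> 0 ^ n * norm_poly f G ^ degree \<Phi>"
    by (subst norm_poly_cong[OF monic H0]) (simp add: norm_poly_smult[OF monic] norm_poly_power[OF monic] n)
  then have H_unit: "norm_poly f H dvd 1"
    using G_unit \<Phi>0 by (auto simp: is_unit_mult_iff dvd_one_power)
  have "norm_poly f (Q * G * W * H) dvd 1"
    using unit G_unit W_unit H_unit by (simp add: norm_poly_mult[OF monic] is_unit_mult_iff)
  from ex[OF this]
  obtain x where x: "poly f x dvd 1" "poly Q x dvd 1" "poly G x dvd 1" "poly W x dvd 1"
      "poly H x dvd 1"
    by (auto simp: is_unit_mult_iff)
  obtain u where u: "poly f x * u = 1" using x(1) by (metis dvdE)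
  obtain w where w: "poly G x * w = 1" using x(3) by (metis dvdE)
  define \<rho> where "\<rho> = poly G x * u"
  define \<sigma> where "\<sigma> = poly f x * w"
  have \<rho>\<sigma>: "\<rho> * \<sigma> = 1"
  proof -
    have "\<rho> * \<sigma> = (poly f x * u) * (poly G x * w)" by (simp add: \<rho>_def \<sigma>_def ac_simps)
    then show ?thesis by (simp add: u w)
  qed
  have \<rho>f: "\<rho> * poly f x = poly G x"
    using u by (simp add: \<rho>_def mult.assoc mult.commute[of u])
  have \<sigma>G: "\<sigma> * poly G x = poly f x"
    using w by (simp add: \<sigma>_def mult.assoc mult.commute[of w])
  \<comment> \<open>Since \<open>\<rho> \<sigma> = 1\<close>, this is
    \<open>\<sigma> (h0 + \<rho> r)\<close>, the monic normalization of the cofactor of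
    \<open>f\<close> once \<open>\<rho> f\<close> is subtracted from \<open>G\<close>.\<close>
  define h where "h = r + smult \<sigma> h0"
  have h: "lead_coeff h = 1" "degree h = n - 2"
    using monic_add_lower[OF r(1), of "smult \<sigma> h0"] h0 by (simp_all add: h_def r)
  have h_unit: "norm_poly h Q dvd 1"
    using x(5) H[OF \<sigma>G] by (simp add: h_def \<Phi> is_unit_mult_iff)
  \<comment> \<open>The coefficient of \<open>X^n\<close> in \<open>G - \<rho> f\<close>. As this
    polynomial vanishes at \<open>x\<close>, dividing by \<open>X - x\<close> leaves
    \<open>\<pi>\<close> times the monic \<open>p\<close>.\<close>
  define \<pi> where "\<pi> = coeff G n - \<rho>"
  have "\<pi> * poly f x = poly W x"
    by (simp add: \<pi>_def W_def left_diff_distrib \<rho>f)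
  then have \<pi>_unit: "\<pi> dvd 1" using x(4) by (metis is_unit_mult_iff)
  then obtain \<pi>' where \<pi>': "\<pi> * \<pi>' = 1" by (metis dvdE)
  have "poly (G - smult \<rho> f) x = 0" by (simp add: \<rho>f)
  then obtain p1 where p1: "G - smult \<rho> f = [:- x, 1:] * p1"
    unfolding poly_eq_0_iff_dvd by (elim dvdE)
  have top: "coeff (G - smult \<rho> f) n = \<pi>"
    using monic by (simp add: \<pi>_def n)
  have p1_ne: "p1 \<noteq> 0" using top \<pi>_unit by (auto simp: p1)
  have "degree (G - smult \<rho> f) \<le> n"
    using degG n by (intro degree_diff_le) auto
  then have "degree (G - smult \<rho> f) = n"
    using top \<pi>_unit by (intro antisym le_degree) auto
  then have deg_p1: "degree p1 = n - 1"
    using p1_ne by (simp add: p1 degree_mult_eq del: mult_pCons_left)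
  have "lead_coeff (G - smult \<rho> f) = lead_coeff p1"
    unfolding p1 lead_coeff_mult by simp
  then have lc_p1: "lead_coeff p1 = \<pi>"
    using \<open>degree (G - smult \<rho> f) = n\<close> top by simp
  define p where "p = smult \<pi>' p1"
  have \<pi>'0: "\<pi>' \<noteq> 0" using \<pi>' by auto
  have p: "lead_coeff p = 1" "degree p = n - 1"
    using \<pi>' \<pi>'0 lc_p1 deg_p1 by (simp_all add: p_def mult.commute)
  have p1_eq: "p1 = smult \<pi> p" using \<pi>' by (simp add: p_def)
  define P where "P = r * ([:- x, 1:] * p)"
  have P: "lead_coeff P = 1" unfolding P_def lead_coeff_mult using r p by simp
  have degP: "degree P = 2 * (n - 1)"
  proof -
    have "p \<noteq> 0" "r \<noteq> 0" using p r by auto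
    then show ?thesis
      using n by (simp add: P_def degree_mult_eq r p del: mult_pCons_left)
  qed
  \<comment> \<open>Regroup \<open>f h0 + r G\<close> as
    \<open>f (h0 + \<rho> r) + r (G - \<rho> f)\<close>.\<close>
  have Q_eq: "Q = f * smult \<rho> h + smult \<pi> P"
  proof -
    have "f * smult \<rho> h = smult \<rho> (f * r) + smult (\<rho> * \<sigma>) (f * h0)"
      by (simp add: h_def algebra_simps smult_add_right)
    moreover have "smult \<pi> P = r * (G - smult \<rho> f)"
      by (simp add: p1 p1_eq P_def del: mult_pCons_left)
    ultimately show ?thesis
      by (simp add: QG \<rho>\<sigma> algebra_simps)
  qed
  have k1: "norm_poly f Q = \<pi> ^ n * norm_poly f P"
    using norm_poly_cong[OF monic, of Q "smult \<pi> P"] by (simp add: Q_eq norm_poly_smult[OF monic] n dvd_smult)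
  \<comment> \<open>The degree of \<open>P\<close> is even, so reciprocity introduces no sign, here
    and in \<open>k4\<close>.\<close>
  have k2: "norm_poly f P = norm_poly P f"
    by (subst norm_poly_swap[OF monic P]) (simp add: degP)
  have k3: "norm_poly P Q = norm_poly P f * ((\<rho> ^ (n - 1))\<^sup>2 * norm_poly P h)"
  proof -
    have "norm_poly P Q = norm_poly P (f * smult \<rho> h)"
      by (intro norm_poly_cong[OF P]) (simp add: Q_eq dvd_smult)
    then show ?thesis
      by (simp add: norm_poly_mult[OF P] norm_poly_smult[OF P] degP power_mult mult.commute[of 2])
  qed
  have k4: "norm_poly P h = norm_poly h P"
    by (subst norm_poly_swap[OF P h(1)]) (simp add: degP)
  have k5: "norm_poly h Q = \<pi> ^ (n - 2) * norm_poly h P"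
    using norm_poly_cong[OF h(1), of Q "smult \<pi> P"]
    by (simp add: Q_eq norm_poly_smult[OF h(1)] h(2) dvd_smult)
  have k6: "norm_poly P Q = poly Q a ^ (n - 2) * (poly Q x * norm_poly p Q)"
  proof -
    have "lead_coeff ([:- x, 1:] * p) = 1" unfolding lead_coeff_mult using p by simp
    then have "norm_poly P Q = norm_poly r Q * norm_poly ([:- x, 1:] * p) Q"
      unfolding P_def by (intro norm_poly_modulus_mult r)
    moreover have "norm_poly ([:- x, 1:] * p) Q = norm_poly [:- x, 1:] Q * norm_poly p Q"
      by (intro norm_poly_modulus_mult p) simp
    ultimately show ?thesis
      by (simp only: r_def norm_poly_linear_power norm_poly_linear)
  qed
  \<comment> \<open>The powers of \<open>\<pi>\<close> from the moduli \<open>f\<close> and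
    \<open>h\<close> combine to a square, which \<open>D_q_square\<close> can absorb.\<close>
  have k7: "\<pi> ^ n * \<pi> ^ (n - 2) = (\<pi> ^ (n - 1))\<^sup>2"
  proof -
    have "n + (n - 2) = (n - 1) * 2" using n(2) by simp
    then show ?thesis by (simp only: flip: power_add power_mult)
  qed
  have "norm_poly f Q * (\<rho> ^ (n - 1))\<^sup>2 * norm_poly h Q
      = (\<pi> ^ n * \<pi> ^ (n - 2)) * (norm_poly P f * ((\<rho> ^ (n - 1))\<^sup>2 * norm_poly P h))"
    unfolding k1 k2 k4 k5 by (simp only: ac_simps)
  also have "\<dots> = (\<pi> ^ (n - 1))\<^sup>2 * norm_poly P Q" unfolding k7 k3 ..
  also have "\<dots> = (\<pi> ^ (n - 1))\<^sup>2 * poly Q a ^ (n - 2) * poly Q x * norm_poly p Q"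
    unfolding k6 by (simp only: ac_simps)
  finally have "norm_poly f Q * (\<rho> ^ (n - 1))\<^sup>2 * norm_poly h Q
      = (\<pi> ^ (n - 1))\<^sup>2 * poly Q a ^ (n - 2) * poly Q x * norm_poly p Q" .
  moreover have "\<rho> dvd 1" using \<rho>\<sigma> by (metis dvdI)
  ultimately show thesis
    using that[of p h \<pi> \<rho> a x] p h \<pi>_unit a(2) x(2) h_unit by blast
qed

text \<open>Strong induction on the degree of \<open>f\<close>. Reducing \<open>v\<close> modulo
  \<open>f\<close> gives the degree bound needed for \<open>norm_poly_reduction\<close>, whose
  identity expresses the norm through squares of units, values of the form, and norms modulo
  \<open>p\<close> and \<open>h\<close> of smaller degree.\<close>

lemma norm_poly_qform_in_D_q:
  fixes a :: "nat \<Rightarrow> nat \<Rightarrow> 'r" and v :: "nat \<Rightarrow> 'r poly"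
  assumes char: "residue_char_zero R" and "lead_coeff f = 1"
    and "norm_poly f (qform m (\<lambda>i j. [:a i j:]) v) dvd 1"
  shows "norm_poly f (qform m (\<lambda>i j. [:a i j:]) v) \<in> D_q m a"
  using assms(2,3)
proof (induction "degree f" arbitrary: f v rule: less_induct)
  case less
  note monic = less.prems(1)
  define n where "n = degree f"
  have "\<exists>w. \<forall>i. f dvd v i - w i \<and> (\<forall>k\<ge>n. coeff (w i) k = 0)"
    unfolding n_def using ex_monic_remainder[OF monic, of "v _"] by (intro choice) blast
  then obtain w where w: "\<And>i. f dvd v i - w i" "\<And>i k. k \<ge> n \<Longrightarrow> coeff (w i) k = 0" by blast
  define Q where "Q = qform m (\<lambda>i j. [:a i j:]) w"
  have vQ: "norm_poly f (qform m (\<lambda>i j. [:a i j:]) v) = norm_poly f Q"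
    unfolding Q_def by (intro norm_poly_cong[OF monic] qform_cong_dvd w)
  have unit: "norm_poly f Q dvd 1" using less.prems(2) by (simp add: vQ)
  have Q_value: "poly Q x \<in> D_q m a" if "poly Q x dvd 1" for x
    using that unfolding Q_def poly_qform by (rule D_q_value)
  consider "n = 0" | "n = 1" | "n \<ge> 2" by linarith
  then have "norm_poly f Q \<in> D_q m a"
  proof cases
    \<comment> \<open>This case is reached in the induction: \<open>h\<close> has degree 0 when
      \<open>n = 2\<close>.\<close>
    case 1
    then have "norm_poly f Q = 1" by (simp add: norm_poly_def det_nat_def flip: n_def)
    then show ?thesis by (simp add: D_q_one)
  next
    case 2
    then have "f = [:- (- coeff f 0), 1:]"
      using monic_eq_monom_plus[OF monic] by (simp add: monom_altdef flip: n_def)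
    then have "norm_poly f Q = poly Q (- coeff f 0)"
      using norm_poly_linear by metis
    then show ?thesis using Q_value unit by simp
  next
    case 3
    have "degree (w i) \<le> n - 1" for i using w(2) 3 by (intro degree_le) auto
    then have "degree Q \<le> 2 * (n - 1)" unfolding Q_def by (rule degree_qform_le)
    from norm_poly_reduction[OF char monic n_def[symmetric] 3 this unit]
    obtain b x \<pi> \<rho> p h where *:
      "lead_coeff p = 1" "degree p = n - 1" "lead_coeff h = 1" "degree h = n - 2"
      "\<pi> dvd 1" "\<rho> dvd 1" "poly Q b dvd 1" "poly Q x dvd 1" "norm_poly h Q dvd 1"
      and eq: "norm_poly f Q * (\<rho> ^ (n - 1))\<^sup>2 * norm_poly h Q
      = (\<pi> ^ (n - 1))\<^sup>2 * poly Q b ^ (n - 2) * poly Q x * norm_poly p Q"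
      by metis
    have sq: "(y ^ (n - 1))\<^sup>2 \<in> D_q m a" if "y dvd 1" for y
      using *(7) that unfolding Q_def poly_qform
      by (elim D_q_square) (simp add: dvd_one_power)
    have "norm_poly f Q * (\<rho> ^ (n - 1))\<^sup>2 * norm_poly h Q dvd 1"
      using unit * by (simp add: is_unit_mult_iff dvd_one_power)
    \<comment> \<open>That the norm modulo \<open>p\<close> is a unit is read off the identity,
      whose left side is a unit.\<close>
    then have "norm_poly p Q dvd 1" unfolding eq by (simp add: is_unit_mult_iff)
    then have "norm_poly p Q \<in> D_q m a"
      unfolding Q_def using * 3 by (intro less.hyps) (auto simp flip: n_def)
    moreover have "norm_poly h Q \<in> D_q m a"
      using *(9) unfolding Q_def using * 3 by (intro less.hyps) (auto simp flip: n_def)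
    ultimately show ?thesis
      using eq * sq[of \<rho>] sq[of \<pi>] Q_value by (metis D_q_cancel D_q_mult D_q_power)
  qed
  then show ?case by (simp add: vQ)
qed

end

subsection \<open>Simple extensions\<close>

locale simple_extension =
  fixes \<phi> :: "'r::idom \<Rightarrow> 's::comm_ring_1" and n :: nat and c :: 's
  assumes ext: "simple_ext \<phi> n c"
begin

sublocale comm_ring_hom \<phi>
proof -
  have add: "\<phi> (x + y) = \<phi> x + \<phi> y" for x y
    using ext by (simp add: simple_ext_def ring_mono_def)
  have "\<phi> 0 = 0" using add[of 0 0] by simp
  then show "comm_ring_hom \<phi>"
    using ext by unfold_locales (simp_all add: simple_ext_def ring_mono_def)
qed

sublocale lift: map_poly_comm_ring_hom \<phi> ..

text \<open>The surjection from \<open>R[X]\<close> to \<open>S\<close> sending \<open>X\<close> to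
  \<open>c\<close>; it transfers the polynomial norm principle to \<open>S\<close>.\<close>

definition eval :: "'r poly \<Rightarrow> 's" where
  "eval P = poly (map_poly \<phi> P) c"

lemma eval_diff: "eval (P - Q) = eval P - eval Q"
  and eval_mult: "eval (P * Q) = eval P * eval Q"
  and eval_monom: "eval (monom r i) = \<phi> r * c ^ i"
  and eval_const: "eval [:r:] = \<phi> r"
  and eval_0: "eval 0 = 0"
  by (simp_all add: eval_def hom_distribs poly_monom)

lemma eval_sum: "eval (\<Sum>i\<in>I. P i) = (\<Sum>i\<in>I. eval (P i))"
  by (simp add: eval_def hom_distribs poly_sum)

lemma basis_unique:
  assumes "(\<Sum>i<n. \<phi> (a i) * c ^ i) = (\<Sum>i<n. \<phi> (b i) * c ^ i)" and "i < n"
  shows "a i = b i"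
  using ext assms unfolding simple_ext_def is_basis_def by blast

lemma eval_surj: "\<exists>P. eval P = s"
proof -
  obtain a where "s = (\<Sum>i<n. \<phi> (a i) * c ^ i)"
    using ext unfolding simple_ext_def is_basis_def by blast
  then show ?thesis
    by (intro exI[of _ "\<Sum>i<n. monom (a i) i"]) (simp add: eval_sum eval_monom)
qed

lemma eval_qform: "eval (qform m (\<lambda>i j. [:a i j:]) v) = qform m (\<lambda>i j. \<phi> (a i j)) (\<lambda>i. eval (v i))"
  unfolding qform_def eval_sum
  by (intro sum.cong refl) (simp add: eval_mult eval_const eval_0 del: mult_pCons_left)

text \<open>Expanding \<open>c^n\<close> in the basis gives the monic relation that presents
  \<open>S\<close> as \<open>R[X]/f\<close>.\<close>

lemma ex_min_poly: "\<exists>f. lead_coeff f = 1 \<and> degree f = n \<and> eval f = 0"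
proof -
  obtain a where a: "c ^ n = (\<Sum>i<n. \<phi> (a i) * c ^ i)"
    using ext unfolding simple_ext_def is_basis_def by blast
  define f where "f = monom 1 n + (- (\<Sum>i<n. monom (a i) i))"
  have "degree f = n \<and> lead_coeff f = 1"
    using monic_add_lower[of "monom (1::'r) n" "- (\<Sum>i<n. monom (a i) i)"]
    by (simp add: f_def degree_monom_eq coeff_sum_monom_lessThan)
  moreover have "eval f = 0"
    unfolding f_def diff_conv_add_uminus[symmetric]
    by (simp add: eval_diff eval_sum eval_monom a)
  ultimately show ?thesis by blast
qed

text \<open>Column \<open>j\<close> of either matrix expands \<open>eval Q * c^j\<close> in the
  power basis, because \<open>eval\<close> kills multiples of \<open>f\<close>; uniqueness of
  coordinates identifies them.\<close>

lemma norm_map_eval: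
  assumes f: "lead_coeff f = 1" "degree f = n" "eval f = 0"
  shows "norm_map \<phi> n (\<lambda>i. c ^ i) (eval Q) = norm_poly f Q"
proof -
  have entry: "coord \<phi> n (\<lambda>i. c ^ i) (eval Q * c ^ j) i = mult_matrix f Q i j" if "i < n" for i j
  proof -
    let ?x = "coord \<phi> n (\<lambda>i. c ^ i) (eval Q * c ^ j)"
    have "\<exists>a. eval Q * c ^ j = (\<Sum>i<n. \<phi> (a i) * c ^ i)"
      using ext unfolding simple_ext_def is_basis_def by blast
    then have x: "eval Q * c ^ j = (\<Sum>i<n. \<phi> (?x i) * c ^ i)"
      unfolding coord_def by (rule someI_ex)
    obtain g where "Q * monom 1 j - (\<Sum>i<n. monom (mult_matrix f Q i j) i) = f * g"
      using mult_matrix_cong[OF f(1), of Q j] unfolding f(2) by (elim dvdE)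
    then have "eval (Q * monom 1 j - (\<Sum>i<n. monom (mult_matrix f Q i j) i)) = 0"
      by (simp add: eval_mult f(3))
    then have "eval Q * c ^ j = (\<Sum>i<n. \<phi> (mult_matrix f Q i j) * c ^ i)"
      by (simp add: eval_diff eval_mult eval_sum eval_monom)
    with x have "(\<Sum>i<n. \<phi> (?x i) * c ^ i) = (\<Sum>i<n. \<phi> (mult_matrix f Q i j) * c ^ i)"
      by (rule trans[OF sym])
    then show ?thesis using that by (rule basis_unique)
  qed
  \<comment> \<open>\<open>coord\<close> is a choice determined only at indices below
    \<open>n\<close>, the only rows the determinant uses.\<close>
  have "(\<Prod>i<n. coord \<phi> n (\<lambda>i. c ^ i) (eval Q * c ^ (p i)) i) = (\<Prod>i<n. mult_matrix f Q i (p i))"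
    for p by (intro prod.cong) (auto simp: entry)
  then show ?thesis
    unfolding norm_map_def norm_poly_def det_nat_def f(2) by simp
qed

lemma norm_map_mult:
  "norm_map \<phi> n (\<lambda>i. c ^ i) (s * t) = norm_map \<phi> n (\<lambda>i. c ^ i) s * norm_map \<phi> n (\<lambda>i. c ^ i) t"
proof -
  obtain f where f: "lead_coeff f = 1" "degree f = n" "eval f = 0" using ex_min_poly by blast
  obtain P Q where "s = eval P" "t = eval Q" using eval_surj by metis
  then show ?thesis
    by (simp add: norm_map_eval[OF f] norm_poly_mult[OF f(1)] flip: eval_mult)
qed

lemma norm_map_one: "norm_map \<phi> n (\<lambda>i. c ^ i) 1 = 1"
proof -
  obtain f where f: "lead_coeff f = 1" "degree f = n" "eval f = 0" using ex_min_poly by blast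
  have "eval 1 = 1" using eval_const[of 1] by (simp add: one_pCons)
  then show ?thesis
    using norm_map_eval[OF f, of 1] by (simp add: norm_poly_1[OF f(1)])
qed

lemma norm_map_value_in_D_q:
  assumes "is_local_ring TYPE('r)" "residue_char_zero TYPE('r)"
    and unit: "qform m (\<lambda>i j. \<phi> (a i j)) x dvd 1"
  shows "norm_map \<phi> n (\<lambda>i. c ^ i) (qform m (\<lambda>i j. \<phi> (a i j)) x) \<in> D_q m a"
proof -
  interpret local_domain "TYPE('r)" by unfold_locales (fact assms(1))
  obtain f where f: "lead_coeff f = 1" "degree f = n" "eval f = 0" using ex_min_poly by blast
  have "\<exists>v. \<forall>i. eval (v i) = x i" by (intro choice allI eval_surj)
  then obtain v where v: "\<And>i. eval (v i) = x i" by blast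
  let ?s = "qform m (\<lambda>i j. \<phi> (a i j)) x"
  have s: "norm_map \<phi> n (\<lambda>i. c ^ i) ?s = norm_poly f (qform m (\<lambda>i j. [:a i j:]) v)"
    by (simp add: eval_qform v flip: norm_map_eval[OF f])
  \<comment> \<open>By multiplicativity the norm of a unit is a unit, as the polynomial version
    requires.\<close>
  obtain t where "1 = ?s * t" using unit by (rule dvdE)
  then have "norm_map \<phi> n (\<lambda>i. c ^ i) ?s * norm_map \<phi> n (\<lambda>i. c ^ i) t = 1"
    by (simp add: norm_map_one flip: norm_map_mult)
  then have "norm_map \<phi> n (\<lambda>i. c ^ i) ?s dvd 1" by (metis dvdI)
  then show ?thesis
    unfolding s using assms(2) f(1) by (intro norm_poly_qform_in_D_q)
qed

end

theorem theorem4p2: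
  fixes \<phi> :: "'r::idom \<Rightarrow> 's::comm_ring_1"
    and n m :: nat and c :: 's and a :: "nat \<Rightarrow> nat \<Rightarrow> 'r"
  assumes "is_local_ring TYPE('r)"
    and "residue_char_zero TYPE('r)"
    and "simple_ext \<phi> n c"
    and "regular_qform m a"
  shows "norm_map \<phi> n (\<lambda>i. c ^ i) ` D_q m (\<lambda>i j. \<phi> (a i j)) \<subseteq> D_q m a"
proof (rule image_subsetI)
  interpret simple_extension \<phi> n c by unfold_locales (fact assms(3))
  let ?N = "norm_map \<phi> n (\<lambda>i. c ^ i)"
  let ?V = "{v. v dvd 1 \<and> (\<exists>x. v = qform m (\<lambda>i j. \<phi> (a i j)) x)}"
  have V: "?N g \<in> D_q m a" if "g \<in> ?V" for g
    using that norm_map_value_in_D_q[OF assms(1,2)] by auto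
  fix s assume "s \<in> D_q m (\<lambda>i j. \<phi> (a i j))"
  then have "s \<in> unit_subgroup ?V" by (simp add: D_q_def)
  then show "?N s \<in> D_q m a"
  proof induction
    case one
    show ?case by (simp add: norm_map_one D_q_one)
  next
    case (mult x g)
    show ?case
      unfolding norm_map_mult by (intro D_q_mult V mult.IH mult.hyps)
  next
    case (inv x g h)
    \<comment> \<open>Instead of the norm of the inverse \<open>h\<close>, use the relation between
      the norms of \<open>x * h\<close>, \<open>g\<close> and \<open>x\<close>, and cancel the norm
      of the generator \<open>g\<close>.\<close>
    have "x * h * g = x * (g * h)" by (simp add: ac_simps)
    then have "x * h * g = x" using inv.hyps(3) by simp
    then have "?N (x * h) * ?N g = ?N x" by (metis norm_map_mult)
    then have "?N (x * h) * ?N g \<in> D_q m a" using inv.IH by simp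
    then show ?case by (rule D_q_cancel) (intro V inv.hyps)
  qed
qed

end
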